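(* Let $n\ge1$ be an integer, let $\alpha>-1$, and let $w_\alpha(x)=(1+|x|^2)^{(\alpha+n+1)/2}$ for $x\in\mathbb{R}^n$. For $f\in L^1(w_\alpha^{-1})$ set $\mathcal{K}_\alpha[f](x,y)=\int_{\mathbb{R}^n}\mathcal{K}_\alpha(x-\eta,y)f(\eta)\,d\eta$ for $x\in\mathbb{R}^n$, $y>0$. (1) If $f\in L^1(w_\alpha^{-1})$, then $$\sup_{(x,y)\in S_r}\big|\mathcal{K}_\alpha[f](x,y)\cos^n\vartheta\big|=o(r^{\alpha+1})\quad\text{as }r\to\infty.$$ (2) This order relation is sharp in the following sense. Let $\beta,\gamma\in\mathbb{R}$ be such that either $\beta+\gamma<\alpha+n+1$, or $\beta+\gamma=\alpha+n+1$ and $\gamma<n$. Then there are positive real numbers $f_k,a_k,\varrho_k$ with $\varrho_k<1$, $a_k\to\infty$ as $k\to\infty$, such that the balls $B_{\varrho_k}(a_k\hat e_1)\subset\mathbb{R}^n$ are disjoint, the continuous function $f$ defined by $f(x)=f_k\big(1-\frac{1}{\varrho_k}|x-a_k\hat e_1|\big)$ for $x\in B_{\varrho_k}(a_k\hat e_1)$ and $f(x)=0$ outside these balls belongs to $L^1(w_\alpha^{-1})$, and $r^{-\beta}\,\mathcal{K}_\alpha[f](x,y)\cos^\gamma\vartheta$ does not tend to zero along the sequence $(x^{(k)},y^{(k)})=(a_k\hat e_1,\varrho_k)$ as $k\to\infty$.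
   Context: The kernel is $\mathcal{K}_\alpha(x,y)=\frac{\Gamma((\alpha+n+1)/2)}{\Gamma((\alpha+1)/2)\pi^{n/2}}\cdot\frac{y^{\alpha+1}}{(|x|^2+y^2)^{(\alpha+n+1)/2}}$ for $x\in\mathbb{R}^n$, $y>0$. $L^1(w_\alpha^{-1})$ is the space of measurable $f$ on $\mathbb{R}^n$ with $\int|f|\,w_\alpha^{-1}\,dx<\infty$. For $(x,y)\in\mathbb{R}^n\times(0,\infty)$, $r=(|x|^2+y^2)^{1/2}$ and $\vartheta\in[0,\pi/2)$ is the angle with $y=r\cos\vartheta$, $|x|=r\sin\vartheta$; $S_r=\{(x,y)\in\mathbb{R}^n\times(0,\infty):|x|^2+y^2=r^2\}$. $\hat e_1$ is the unit vector along the $x_1$ axis, and $B_\varrho(a)$ is the ball in $\mathbb{R}^n$ with center $a$ and radius $\varrho$. *)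

theory Defs
  imports "HOL-Analysis.Analysis" "HOL-Library.Landau_Symbols"
begin

text \<open>The space \<open>\<real>\<^sup>n\<close> is \<open>real ^ 'n\<close> with \<open>n = CARD('n)\<close>.\<close>

definition K_kernel :: "real \<Rightarrow> real ^ 'n \<Rightarrow> real \<Rightarrow> real" where
  "K_kernel \<alpha> x y =
     Gamma ((\<alpha> + real CARD('n) + 1) / 2) / (Gamma ((\<alpha> + 1) / 2) * pi powr (real CARD('n) / 2)) *
     (y powr (\<alpha> + 1) / ((norm x)\<^sup>2 + y\<^sup>2) powr ((\<alpha> + real CARD('n) + 1) / 2))"

definition weight :: "real \<Rightarrow> real ^ 'n \<Rightarrow> real" where
  "weight \<alpha> x = (1 + (norm x)\<^sup>2) powr ((\<alpha> + real CARD('n) + 1) / 2)"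

text \<open>Measurability is Lebesgue measurability; the elements are functions, not classes of
  almost everywhere equal functions.\<close>

definition L1_weight :: "real \<Rightarrow> (real ^ 'n \<Rightarrow> real) set" where
  "L1_weight \<alpha> = {f. f \<in> borel_measurable lebesgue \<and>
     (\<integral>\<^sup>+ x. ennreal (\<bar>f x\<bar> * inverse (weight \<alpha> x)) \<partial>lebesgue) < \<infinity>}"

definition K_transform :: "real \<Rightarrow> (real ^ 'n \<Rightarrow> real) \<Rightarrow> real ^ 'n \<Rightarrow> real \<Rightarrow> real" where
  "K_transform \<alpha> f x y = (LINT \<eta>|lebesgue. K_kernel \<alpha> (x - \<eta>) y * f \<eta>)"

definition radius :: "real ^ 'n \<Rightarrow> real \<Rightarrow> real" where
  "radius x y = sqrt ((norm x)\<^sup>2 + y\<^sup>2)"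

definition angle :: "real ^ 'n \<Rightarrow> real \<Rightarrow> real" where
  "angle x y = (THE \<theta>. 0 \<le> \<theta> \<and> \<theta> < pi / 2 \<and>
     y = radius x y * cos \<theta> \<and> norm x = radius x y * sin \<theta>)"

definition half_sphere :: "real \<Rightarrow> ((real ^ 'n) \<times> real) set" where
  "half_sphere r = {(x, y). 0 < y \<and> (norm x)\<^sup>2 + y\<^sup>2 = r\<^sup>2}"

lemma angle_unique:
  fixes x :: "real ^ 'n"
  assumes "0 < y"
  shows "\<exists>!\<theta>. 0 \<le> \<theta> \<and> \<theta> < pi / 2 \<and>
           y = radius x y * cos \<theta> \<and> norm x = radius x y * sin \<theta>"
proof -
  let ?r = "radius x y"
  have r: "0 < ?r" "?r\<^sup>2 = (norm x)\<^sup>2 + y\<^sup>2"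
    using assms by (auto simp: radius_def add_nonneg_pos)
  have "(y / ?r)\<^sup>2 + (norm x / ?r)\<^sup>2 = 1"
    using r by (simp add: power_divide add_divide_distrib[symmetric] add.commute[of "y\<^sup>2"]
        flip: r(2))
  then obtain t where t: "0 \<le> t" "t \<le> pi / 2" "y / ?r = cos t" "norm x / ?r = sin t"
    using sincos_total_pi_half[of "y / ?r" "norm x / ?r"] assms r(1) by force
  have "t \<noteq> pi / 2"
    using t(3) assms r(1) cos_pi_half by (metis divide_pos_pos less_irrefl)
  show ?thesis
  proof (rule ex1I[of _ t])
    show "0 \<le> t \<and> t < pi / 2 \<and> y = ?r * cos t \<and> norm x = ?r * sin t"
      using t \<open>t \<noteq> pi / 2\<close> r(1) by (simp add: t(3)[symmetric] t(4)[symmetric])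
  next
    fix s
    assume s: "0 \<le> s \<and> s < pi / 2 \<and> y = ?r * cos s \<and> norm x = ?r * sin s"
    then have "?r * cos s = ?r * cos t"
      using t(3) r(1) by (simp add: field_simps)
    then have "cos s = cos t"
      using r(1) by simp
    then show "s = t"
      using s t cos_inj_pi[of s t] pi_gt_zero by linarith
  qed
qed

lemma angle:
  fixes x :: "real ^ 'n"
  assumes "0 < y"
  shows "0 \<le> angle x y" "angle x y < pi / 2"
    "y = radius x y * cos (angle x y)" "norm x = radius x y * sin (angle x y)"
  using theI'[OF angle_unique[OF assms, of x]] unfolding angle_def by blast+

end

theory Submission
  imports Defs
begin

text \<open>
  Put \<open>s = \<alpha> + n + 1\<close> and \<open>r\<^sup>2 = \<bar>x\<bar>\<^sup>2 + y\<^sup>2\<close>. Since \<open>cos \<theta> = y / r\<close>, the powers of \<open>y\<close> in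
  \<open>K(x - \<eta>, y) cos\<^sup>n \<theta>\<close> combine to \<open>y\<^sup>s\<close>, which has the same degree as the
  denominator of the kernel. Hence this product is a constant times \<open>r powr (\<alpha> + 1)\<close> times
  \<open>w(\<eta>)\<^sup>-\<^sup>1\<close> times the power \<open>s / 2\<close> of the quotient
  \<open>y\<^sup>2 (1 + \<bar>\<eta>\<bar>\<^sup>2) / (r\<^sup>2 (\<bar>x - \<eta>\<bar>\<^sup>2 + y\<^sup>2))\<close> (\<open>K_kernel_factor\<close>). For \<open>r \<ge> 1\<close> this quotient is
  at most \<open>3\<close>, and it is at most \<open>(1 + \<bar>\<eta>\<bar>\<^sup>2) / r\<^sup>2\<close> (\<open>kernel_ratio_le\<close>). Both bounds depend on \<open>(x, y)\<close>
  only through \<open>r\<close>, so they hold uniformly on the half sphere; the second tends to \<open>0\<close> for each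
  \<open>\<eta>\<close>, the first is an integrable majorant after multiplication by \<open>\<bar>f\<bar> w\<^sup>-\<^sup>1\<close>, and dominated
  convergence gives the \<open>o(r powr (\<alpha> + 1))\<close> estimate (\<open>K_transform_smallo\<close>).

  For sharpness, the value of the transform at the point above the centre of a bump, at height
  equal to the radius \<open>\<rho>\<close> of the bump, is at least a fixed multiple of the height \<open>c\<close> of the bump,
  because the kernel has mass of order \<open>1\<close> at that scale (\<open>K_transform_lower_bound\<close>). Choosing
  \<open>c = r powr (\<beta> + \<gamma>) * \<rho> powr (- \<gamma>)\<close> keeps the quantity in question
  away from \<open>0\<close>. The weighted norm of such a bump is of order
  \<open>c * \<rho> ^ n * r powr (- s) = r powr (\<beta> + \<gamma> - s) * \<rho> powr (n - \<gamma>)\<close>.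
  With centres at distance \<open>2 ^ (k + 2)\<close> from the origin this is summable in \<open>k\<close>:
  if \<open>\<beta> + \<gamma> < s\<close> through the first factor with \<open>\<rho> = 1 / 2\<close>, and if \<open>\<beta> + \<gamma> = s\<close> and \<open>\<gamma> < n\<close> through the second factor with
  \<open>\<rho> = 2 powr (- k - 1)\<close>.
\<close>

section \<open>The kernel in polar form\<close>

definition kernel_const :: "real \<Rightarrow> real \<Rightarrow> real" where
  "kernel_const \<alpha> n = Gamma ((\<alpha> + n + 1) / 2) / (Gamma ((\<alpha> + 1) / 2) * pi powr (n / 2))"

lemma kernel_const_pos:
  assumes "\<alpha> > -1" "n \<ge> 0"
  shows "kernel_const \<alpha> n > 0"
  using assms unfolding kernel_const_def by (intro divide_pos_pos mult_pos_pos Gamma_real_pos) auto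

lemma K_kernel_eq:
  "K_kernel \<alpha> (x :: real ^ 'n) y = kernel_const \<alpha> (real CARD('n)) *
     (y powr (\<alpha> + 1) / ((norm x)\<^sup>2 + y\<^sup>2) powr ((\<alpha> + real CARD('n) + 1) / 2))"
  by (simp add: K_kernel_def kernel_const_def)

lemma K_kernel_nonneg:
  assumes "\<alpha> > -1"
  shows "K_kernel \<alpha> (x :: real ^ 'n) y \<ge> 0"
  using kernel_const_pos[OF assms, of "real CARD('n)"] unfolding K_kernel_eq by simp

lemma weight_pos: "weight \<alpha> x > 0"
proof -
  have "1 + (norm x)\<^sup>2 > 0" by (simp add: add_pos_nonneg)
  then show ?thesis unfolding weight_def by simp
qed

lemma measurable_weight [measurable]: "weight \<alpha> \<in> borel_measurable borel"
  unfolding weight_def by measurable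

lemma measurable_K_kernel [measurable]:
  "(\<lambda>\<eta>. K_kernel \<alpha> (x - \<eta>) y) \<in> borel_measurable borel"
  unfolding K_kernel_def by measurable

lemma radius_pos: "y > 0 \<Longrightarrow> radius x y > 0"
  by (simp add: radius_def add_nonneg_pos)

lemma radius_power2: "(radius x y)\<^sup>2 = (norm x)\<^sup>2 + y\<^sup>2"
  by (simp add: radius_def)

lemma cos_angle:
  assumes "y > 0"
  shows "cos (angle x y) = y / radius x y"
  using angle(3)[OF assms, of x] radius_pos[OF assms, of x] by (simp add: field_simps)

text \<open>The part of the kernel left after the weight and a power of the radius are split off; see
  \<open>K_kernel_factor\<close>.\<close>

definition kernel_ratio :: "real ^ 'n \<Rightarrow> real \<Rightarrow> real ^ 'n \<Rightarrow> real" where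
  "kernel_ratio x y \<eta> = y\<^sup>2 * (1 + (norm \<eta>)\<^sup>2) / ((radius x y)\<^sup>2 * ((norm (x - \<eta>))\<^sup>2 + y\<^sup>2))"

lemma kernel_ratio_nonneg: "kernel_ratio x y \<eta> \<ge> 0"
  unfolding kernel_ratio_def by simp

text \<open>The bound \<open>3\<close> comes from \<open>1 + \<bar>\<eta>\<bar>\<^sup>2 \<le> 1 + 2 \<bar>x\<bar>\<^sup>2 + 2 \<bar>x - \<eta>\<bar>\<^sup>2\<close> with \<open>1\<close>, \<open>\<bar>x\<bar>\<^sup>2\<close> and \<open>y\<^sup>2\<close> each
  at most \<open>r\<^sup>2\<close>; the other bound drops \<open>\<bar>x - \<eta>\<bar>\<^sup>2\<close> from the denominator.\<close>

lemma kernel_ratio_le: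
  fixes x \<eta> :: "real ^ 'n"
  assumes y: "y > 0" and r: "radius x y \<ge> 1"
  shows "kernel_ratio x y \<eta> \<le> min 3 ((1 + (norm \<eta>)\<^sup>2) / (radius x y)\<^sup>2)"
proof -
  define R A where "R = (radius x y)\<^sup>2" and "A = (norm (x - \<eta>))\<^sup>2"
  have R: "R \<ge> 1" "R = (norm x)\<^sup>2 + y\<^sup>2"
    using r one_le_power[OF r, of 2] by (auto simp: R_def radius_power2)
  have A: "A \<ge> 0" and y2: "y\<^sup>2 > 0" using y by (auto simp: A_def)
  have "norm \<eta> \<le> norm x + norm (x - \<eta>)"
    by (metis norm_triangle_sub add.commute norm_minus_commute)
  then have "(norm \<eta>)\<^sup>2 \<le> (norm x + norm (x - \<eta>))\<^sup>2" by (simp add: power_mono)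
  also have "\<dots> \<le> 2 * (norm x)\<^sup>2 + 2 * A"
    using sum_squares_bound[of "norm x" "norm (x - \<eta>)"] by (simp add: A_def power2_sum)
  finally have eta: "1 + (norm \<eta>)\<^sup>2 \<le> 3 * R + 2 * A" using R y2 by linarith
  have "y\<^sup>2 * (1 + (norm \<eta>)\<^sup>2) \<le> y\<^sup>2 * (3 * R + 2 * A)"
    using eta by (intro mult_left_mono) auto
  also have "\<dots> = 3 * R * y\<^sup>2 + 2 * A * y\<^sup>2" by (simp add: algebra_simps)
  also have "2 * A * y\<^sup>2 \<le> 3 * A * R"
    using A R by (intro mult_mono) auto
  finally have "y\<^sup>2 * (1 + (norm \<eta>)\<^sup>2) \<le> 3 * (R * (A + y\<^sup>2))"
    by (simp add: algebra_simps)
  moreover have "R * (A + y\<^sup>2) > 0" using R(1) A y2 by (intro mult_pos_pos add_nonneg_pos) auto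
  ultimately have 1: "kernel_ratio x y \<eta> \<le> 3"
    unfolding kernel_ratio_def R_def[symmetric] A_def[symmetric] by (simp only: pos_divide_le_eq)
  have "kernel_ratio x y \<eta> = y\<^sup>2 / (A + y\<^sup>2) * ((1 + (norm \<eta>)\<^sup>2) / R)"
    unfolding kernel_ratio_def R_def[symmetric] A_def[symmetric] by simp
  also have "\<dots> \<le> 1 * ((1 + (norm \<eta>)\<^sup>2) / R)"
    using A R y2 add_nonneg_pos[OF A y2] by (intro mult_right_mono) (auto simp: divide_le_eq_1)
  finally show ?thesis using 1 by (simp add: R_def)
qed

text \<open>With \<open>p = (\<alpha> + n + 1) / 2\<close>, the identity \<open>(t\<^sup>2) powr p = t powr (\<alpha> + 1) * t ^ n\<close> is used
  twice, for \<open>t = y\<close> and for \<open>t = r\<close>: the factor \<open>cos ^ n\<close> is the one for which the exponents match.\<close>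

lemma K_kernel_factor:
  fixes x \<eta> :: "real ^ 'n"
  assumes y: "y > 0"
  shows "K_kernel \<alpha> (x - \<eta>) y * cos (angle x y) ^ CARD('n) =
    kernel_const \<alpha> (real CARD('n)) * radius x y powr (\<alpha> + 1) *
    (kernel_ratio x y \<eta> powr ((\<alpha> + real CARD('n) + 1) / 2) * inverse (weight \<alpha> \<eta>))"
proof -
  define r where "r = radius x y"
  define n where "n = real CARD('n)"
  define p where "p = (\<alpha> + n + 1) / 2"
  define D where "D = (norm (x - \<eta>))\<^sup>2 + y\<^sup>2"
  define W where "W = 1 + (norm \<eta>)\<^sup>2"
  have r: "r > 0" using radius_pos[OF y] by (simp add: r_def)
  have D: "D > 0" using y by (simp add: D_def add_nonneg_pos)
  have W: "W > 0" by (simp add: W_def add_pos_nonneg)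
  have sq: "(t\<^sup>2) powr p = t powr (\<alpha> + 1) * t ^ CARD('n)" if "t > 0" for t :: real
  proof -
    have "(t\<^sup>2) powr p = t powr (2 * p)"
      using that by (simp add: powr_powr flip: powr_numeral)
    also have "2 * p = (\<alpha> + 1) + n" by (simp add: p_def)
    finally show ?thesis using that by (simp add: powr_add n_def powr_realpow)
  qed
  have "kernel_ratio x y \<eta> powr p = (y\<^sup>2) powr p * W powr p / ((r\<^sup>2) powr p * D powr p)"
    unfolding kernel_ratio_def r_def[symmetric] D_def[symmetric] W_def[symmetric]
    using r D W by (simp add: powr_divide powr_mult)
  also have "\<dots> = y powr (\<alpha> + 1) * y ^ CARD('n) * W powr p /
      (r powr (\<alpha> + 1) * r ^ CARD('n) * D powr p)"
    using y r by (simp add: sq)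
  finally have rt: "kernel_ratio x y \<eta> powr p = \<dots>" .
  have "weight \<alpha> \<eta> = W powr p" by (simp add: weight_def W_def p_def n_def)
  then show ?thesis
    unfolding K_kernel_eq cos_angle[OF y] n_def[symmetric] p_def[symmetric] rt
      r_def[symmetric] D_def[symmetric]
    using r D W by (simp add: field_simps)
qed

section \<open>The growth estimate\<close>

text \<open>The minimum of both bounds is kept in one function of \<open>r\<close> and \<open>\<eta>\<close>: the constant serves for
  domination, the other term for pointwise convergence.\<close>

definition majorant :: "real \<Rightarrow> real \<Rightarrow> real ^ 'n \<Rightarrow> real" where
  "majorant \<alpha> r \<eta> = (min 3 ((1 + (norm \<eta>)\<^sup>2) / r\<^sup>2)) powr ((\<alpha> + real CARD('n) + 1) / 2)"

lemma measurable_majorant [measurable]: "majorant \<alpha> r \<in> borel_measurable borel"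
  unfolding majorant_def by measurable

lemma majorant_nonneg: "majorant \<alpha> r \<eta> \<ge> 0"
  by (simp add: majorant_def)

lemma majorant_le:
  fixes \<eta> :: "real ^ 'n"
  assumes "\<alpha> > -1"
  shows "majorant \<alpha> r \<eta> \<le> 3 powr ((\<alpha> + real CARD('n) + 1) / 2)"
  unfolding majorant_def using assms by (intro powr_mono2) auto

lemma majorant_tendsto_0:
  fixes \<eta> :: "real ^ 'n"
  assumes "\<alpha> > -1"
  shows "((\<lambda>r. majorant \<alpha> r \<eta>) \<longlongrightarrow> 0) at_top"
proof -
  have "((\<lambda>r. (1 + (norm \<eta>)\<^sup>2) / r\<^sup>2) \<longlongrightarrow> 0) at_top"
    by (intro real_tendsto_divide_at_top[OF tendsto_const] filterlim_pow_at_top filterlim_ident) auto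
  then have "((\<lambda>r. min 3 ((1 + (norm \<eta>)\<^sup>2) / r\<^sup>2)) \<longlongrightarrow> min 3 0) at_top"
    by (intro tendsto_intros)
  then have "((\<lambda>r. min 3 ((1 + (norm \<eta>)\<^sup>2) / r\<^sup>2)) \<longlongrightarrow> 0) at_top" by simp
  then show ?thesis unfolding majorant_def using assms
    by (intro tendsto_zero_powrI[OF _ tendsto_const]) (auto intro!: always_eventually)
qed

lemma K_kernel_le:
  fixes x \<eta> :: "real ^ 'n"
  assumes "\<alpha> > -1" "y > 0" "radius x y \<ge> 1"
  shows "K_kernel \<alpha> (x - \<eta>) y * cos (angle x y) ^ CARD('n) \<le>
    kernel_const \<alpha> (real CARD('n)) * radius x y powr (\<alpha> + 1) *
    (majorant \<alpha> (radius x y) \<eta> * inverse (weight \<alpha> \<eta>))"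
proof -
  have "kernel_ratio x y \<eta> powr ((\<alpha> + real CARD('n) + 1) / 2) \<le> majorant \<alpha> (radius x y) \<eta>"
    unfolding majorant_def using assms kernel_ratio_le[OF assms(2,3), of \<eta>] kernel_ratio_nonneg[of x y \<eta>]
    by (intro powr_mono2) auto
  then show ?thesis
    unfolding K_kernel_factor[OF assms(2)]
    using kernel_const_pos[OF assms(1), of "real CARD('n)"] weight_pos[of \<alpha> \<eta>]
    by (intro mult_left_mono mult_right_mono) auto
qed

lemma L1_weight_iff:
  fixes f :: "real ^ 'n \<Rightarrow> real"
  shows "f \<in> L1_weight \<alpha> \<longleftrightarrow> f \<in> borel_measurable lebesgue \<and>
     integrable lebesgue (\<lambda>\<eta>. \<bar>f \<eta>\<bar> * inverse (weight \<alpha> \<eta>))"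
proof -
  have [measurable]: "weight \<alpha> \<in> borel_measurable (lebesgue :: (real ^ 'n) measure)"
    by (rule measurable_completion) simp
  have [simp]: "norm (\<bar>f \<eta>\<bar> * inverse (weight \<alpha> \<eta>)) = \<bar>f \<eta>\<bar> * inverse (weight \<alpha> \<eta>)" for \<eta>
    using weight_pos[of \<alpha> \<eta>] by simp
  show ?thesis
    unfolding L1_weight_def by (auto simp del: real_norm_def simp: integrable_iff_bounded
        intro!: borel_measurable_times borel_measurable_inverse borel_measurable_abs)
qed

text \<open>At a fixed point with \<open>r \<ge> 1\<close> the kernel is at most a constant multiple of \<open>w\<^sup>-\<^sup>1\<close>, so the
  integral defining the transform converges absolutely.\<close>

lemma K_kernel_times_integrable:
  fixes f :: "real ^ 'n \<Rightarrow> real"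
  assumes a: "\<alpha> > -1" and f: "f \<in> L1_weight \<alpha>" and y: "y > 0" and r: "radius x y \<ge> 1"
  shows "integrable lebesgue (\<lambda>\<eta>. K_kernel \<alpha> (x - \<eta>) y * f \<eta>)"
proof -
  define M where "M = kernel_const \<alpha> (real CARD('n)) * radius x y powr (\<alpha> + 1) *
    3 powr ((\<alpha> + real CARD('n) + 1) / 2)"
  define c where "c = cos (angle x y) ^ CARD('n)"
  have c: "c > 0" using y radius_pos[OF y, of x] by (simp add: c_def cos_angle)
  have fm [measurable]: "f \<in> borel_measurable lebesgue" and
    i: "integrable lebesgue (\<lambda>\<eta>. \<bar>f \<eta>\<bar> * inverse (weight \<alpha> \<eta>))"
    using f by (auto simp: L1_weight_iff)
  have km: "(\<lambda>\<eta>. K_kernel \<alpha> (x - \<eta>) y) \<in> borel_measurable (lebesgue :: (real ^ 'n) measure)"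
    by (rule measurable_completion) simp
  show ?thesis
  proof (rule Bochner_Integration.integrable_bound)
    show "integrable lebesgue (\<lambda>\<eta>. M / c * (\<bar>f \<eta>\<bar> * inverse (weight \<alpha> \<eta>)))"
      using i by simp
    show "(\<lambda>\<eta>. K_kernel \<alpha> (x - \<eta>) y * f \<eta>) \<in> borel_measurable lebesgue"
      using km fm by (rule borel_measurable_times)
    have "norm (K_kernel \<alpha> (x - \<eta>) y * f \<eta>) \<le> norm (M / c * (\<bar>f \<eta>\<bar> * inverse (weight \<alpha> \<eta>)))" for \<eta>
    proof -
      have "K_kernel \<alpha> (x - \<eta>) y * c \<le> kernel_const \<alpha> (real CARD('n)) * radius x y powr (\<alpha> + 1) *
          (majorant \<alpha> (radius x y) \<eta> * inverse (weight \<alpha> \<eta>))"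
        unfolding c_def by (rule K_kernel_le[OF a y r])
      also have "\<dots> \<le> kernel_const \<alpha> (real CARD('n)) * radius x y powr (\<alpha> + 1) *
          (3 powr ((\<alpha> + real CARD('n) + 1) / 2) * inverse (weight \<alpha> \<eta>))"
        using kernel_const_pos[OF a, of "real CARD('n)"] weight_pos[of \<alpha> \<eta>]
        by (intro mult_left_mono mult_right_mono majorant_le[OF a]) auto
      finally have "K_kernel \<alpha> (x - \<eta>) y \<le> M / c * inverse (weight \<alpha> \<eta>)"
        using c by (simp add: pos_le_divide_eq M_def mult_ac)
      then have "K_kernel \<alpha> (x - \<eta>) y * \<bar>f \<eta>\<bar> \<le> M / c * inverse (weight \<alpha> \<eta>) * \<bar>f \<eta>\<bar>"
        by (rule mult_right_mono) simp
      also have "\<dots> = M / c * (\<bar>f \<eta>\<bar> * inverse (weight \<alpha> \<eta>))"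
        by (simp only: mult_ac)
      also have "\<dots> \<le> norm (M / c * (\<bar>f \<eta>\<bar> * inverse (weight \<alpha> \<eta>)))"
        unfolding real_norm_def by (rule abs_ge_self)
      finally show ?thesis using K_kernel_nonneg[OF a, of "x - \<eta>" y] by (simp add: abs_mult)
    qed
    then show "AE \<eta> in lebesgue. norm (K_kernel \<alpha> (x - \<eta>) y * f \<eta>) \<le>
       norm (M / c * (\<bar>f \<eta>\<bar> * inverse (weight \<alpha> \<eta>)))" by simp
  qed
qed

definition majorant_integral :: "real \<Rightarrow> (real ^ 'n \<Rightarrow> real) \<Rightarrow> real \<Rightarrow> real" where
  "majorant_integral \<alpha> f r = (LINT \<eta>|lebesgue. majorant \<alpha> r \<eta> * (\<bar>f \<eta>\<bar> * inverse (weight \<alpha> \<eta>)))"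

lemma majorant_integrable:
  fixes f :: "real ^ 'n \<Rightarrow> real"
  assumes a: "\<alpha> > -1" and f: "f \<in> L1_weight \<alpha>"
  defines "w \<equiv> \<lambda>\<eta>. 3 powr ((\<alpha> + real CARD('n) + 1) / 2) * (\<bar>f \<eta>\<bar> * inverse (weight \<alpha> \<eta>))"
  shows "integrable lebesgue (\<lambda>\<eta>. majorant \<alpha> r \<eta> * (\<bar>f \<eta>\<bar> * inverse (weight \<alpha> \<eta>)))"
    and "integrable lebesgue w"
    and "norm (majorant \<alpha> r \<eta> * (\<bar>f \<eta>\<bar> * inverse (weight \<alpha> \<eta>))) \<le> w \<eta>"
proof -
  have i: "integrable lebesgue (\<lambda>\<eta>. \<bar>f \<eta>\<bar> * inverse (weight \<alpha> \<eta>))"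
    using f by (auto simp: L1_weight_iff)
  then show iw: "integrable lebesgue w" unfolding w_def by simp
  have m: "(\<lambda>\<eta>. majorant \<alpha> r \<eta> * (\<bar>f \<eta>\<bar> * inverse (weight \<alpha> \<eta>))) \<in> borel_measurable lebesgue"
  proof (rule borel_measurable_times)
    show "majorant \<alpha> r \<in> borel_measurable (lebesgue :: (real ^ 'n) measure)"
      by (rule measurable_completion) simp
  qed (use i in auto)
  have b: "norm (majorant \<alpha> r \<eta> * (\<bar>f \<eta>\<bar> * inverse (weight \<alpha> \<eta>))) \<le> w \<eta>" for \<eta>
    using majorant_le[OF a, of r \<eta>] majorant_nonneg[of \<alpha> r \<eta>] weight_pos[of \<alpha> \<eta>]
    unfolding w_def by (auto simp: abs_mult intro!: mult_right_mono)
  then show "norm (majorant \<alpha> r \<eta> * (\<bar>f \<eta>\<bar> * inverse (weight \<alpha> \<eta>))) \<le> w \<eta>" .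
  show "integrable lebesgue (\<lambda>\<eta>. majorant \<alpha> r \<eta> * (\<bar>f \<eta>\<bar> * inverse (weight \<alpha> \<eta>)))"
    by (rule Bochner_Integration.integrable_bound[OF iw m])
      (rule AE_I2, rule order_trans[OF b], simp)
qed

lemma majorant_integral_tendsto_0:
  fixes f :: "real ^ 'n \<Rightarrow> real"
  assumes a: "\<alpha> > -1" and f: "f \<in> L1_weight \<alpha>"
  shows "(majorant_integral \<alpha> f \<longlongrightarrow> 0) at_top"
proof -
  note maj = majorant_integrable[OF a f]
  have "((\<lambda>r. LINT \<eta>|lebesgue. majorant \<alpha> r \<eta> * (\<bar>f \<eta>\<bar> * inverse (weight \<alpha> \<eta>))) \<longlongrightarrow>
      (LINT \<eta>|(lebesgue :: (real ^ 'n) measure). (0::real))) at_top"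
  proof (rule integral_dominated_convergence_at_top
      [OF _ borel_measurable_integrable[OF maj(1)] maj(2)])
    show "AE \<eta> in lebesgue.
        ((\<lambda>r. majorant \<alpha> r \<eta> * (\<bar>f \<eta>\<bar> * inverse (weight \<alpha> \<eta>))) \<longlongrightarrow> 0) at_top"
      by (rule AE_I2) (rule tendsto_mult_left_zero[OF majorant_tendsto_0[OF a]])
  qed (use maj(3) in \<open>auto intro!: always_eventually\<close>)
  then show ?thesis unfolding majorant_integral_def by simp
qed

lemma K_transform_le_majorant_integral:
  fixes f :: "real ^ 'n \<Rightarrow> real"
  assumes a: "\<alpha> > -1" and f: "f \<in> L1_weight \<alpha>" and y: "y > 0" and r: "radius x y \<ge> 1"
  shows "\<bar>K_transform \<alpha> f x y * cos (angle x y) ^ CARD('n)\<bar> \<le>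
    kernel_const \<alpha> (real CARD('n)) * radius x y powr (\<alpha> + 1) * majorant_integral \<alpha> f (radius x y)"
proof -
  define c where "c = cos (angle x y) ^ CARD('n)"
  define C where "C = kernel_const \<alpha> (real CARD('n)) * radius x y powr (\<alpha> + 1)"
  have c: "c > 0" using y radius_pos[OF y, of x] by (simp add: c_def cos_angle)
  have "\<bar>K_transform \<alpha> f x y * c\<bar> = \<bar>LINT \<eta>|lebesgue. K_kernel \<alpha> (x - \<eta>) y * f \<eta> * c\<bar>"
    unfolding K_transform_def by simp
  also have "\<dots> \<le> (LINT \<eta>|lebesgue. \<bar>K_kernel \<alpha> (x - \<eta>) y * f \<eta> * c\<bar>)"
    by (rule integral_abs_bound)
  also have "\<dots> \<le> (LINT \<eta>|lebesgue. C * (majorant \<alpha> (radius x y) \<eta> * (\<bar>f \<eta>\<bar> * inverse (weight \<alpha> \<eta>))))"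
  proof (rule integral_mono)
    fix \<eta> :: "real ^ 'n"
    have "\<bar>K_kernel \<alpha> (x - \<eta>) y * f \<eta> * c\<bar> = K_kernel \<alpha> (x - \<eta>) y * c * \<bar>f \<eta>\<bar>"
      using c K_kernel_nonneg[OF a, of "x - \<eta>" y] by (simp add: abs_mult)
    also have "\<dots> \<le> C * (majorant \<alpha> (radius x y) \<eta> * inverse (weight \<alpha> \<eta>)) * \<bar>f \<eta>\<bar>"
      unfolding C_def c_def by (intro mult_right_mono K_kernel_le a y r) auto
    finally show "\<bar>K_kernel \<alpha> (x - \<eta>) y * f \<eta> * c\<bar> \<le>
        C * (majorant \<alpha> (radius x y) \<eta> * (\<bar>f \<eta>\<bar> * inverse (weight \<alpha> \<eta>)))"
      by (simp add: mult_ac)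
  qed (use K_kernel_times_integrable[OF assms] majorant_integrable(1)[OF a f] in auto)
  finally show ?thesis by (simp add: C_def c_def majorant_integral_def)
qed

lemma K_transform_smallo:
  fixes f :: "real ^ 'n \<Rightarrow> real"
  assumes a: "\<alpha> > -1" and f: "f \<in> L1_weight \<alpha>"
  defines "S \<equiv> \<lambda>r. (\<lambda>(x, y). \<bar>K_transform \<alpha> f x y * cos (angle x y) ^ CARD('n)\<bar>) ` half_sphere r"
  shows "\<forall>\<^sub>F r in at_top. bdd_above (S r)"
    and "(\<lambda>r. Sup (S r)) \<in> o[at_top](\<lambda>r. r powr (\<alpha> + 1))"
proof -
  define C where "C = kernel_const \<alpha> (real CARD('n))"
  have le: "s \<le> C * r powr (\<alpha> + 1) * majorant_integral \<alpha> f r" if "r \<ge> 1" "s \<in> S r" for r s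
  proof -
    from that(2) obtain x y where xy: "y > 0" "(norm x)\<^sup>2 + y\<^sup>2 = r\<^sup>2"
      and s: "s = \<bar>K_transform \<alpha> f x y * cos (angle x y) ^ CARD('n)\<bar>"
      by (auto simp: S_def half_sphere_def)
    have "radius x y = r" using xy that(1) by (simp add: radius_def)
    then show ?thesis using K_transform_le_majorant_integral[OF a f xy(1), of x] that(1) by (simp add: s C_def)
  qed
  have bdd: "bdd_above (S r)" if "r \<ge> 1" for r
    using le[OF that] by (rule bdd_aboveI)
  then show "\<forall>\<^sub>F r in at_top. bdd_above (S r)"
    by (auto intro: eventually_mono[OF eventually_ge_at_top[of 1]])
  have ne: "\<exists>s. s \<in> S r \<and> s \<ge> 0" if "r \<ge> 1" for r
  proof -
    have "(0, r) \<in> half_sphere r" using that by (simp add: half_sphere_def)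
    then have "\<bar>K_transform \<alpha> f 0 r * cos (angle (0 :: real ^ 'n) r) ^ CARD('n)\<bar> \<in> S r"
      unfolding S_def by (rule image_eqI[rotated]) simp
    then show ?thesis using abs_ge_zero by blast
  qed
  have "((\<lambda>r. Sup (S r) / r powr (\<alpha> + 1)) \<longlongrightarrow> 0) at_top"
  proof (rule tendsto_sandwich)
    show "\<forall>\<^sub>F r in at_top. 0 \<le> Sup (S r) / r powr (\<alpha> + 1)"
      using eventually_ge_at_top[of 1]
    proof eventually_elim
      case (elim r)
      obtain s where "s \<in> S r" "s \<ge> 0" using ne[OF elim] by auto
      then have "Sup (S r) \<ge> 0" using cSup_upper[OF _ bdd[OF elim]] by fastforce
      then show ?case by simp
    qed
    show "\<forall>\<^sub>F r in at_top. Sup (S r) / r powr (\<alpha> + 1) \<le> C * majorant_integral \<alpha> f r"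
      using eventually_ge_at_top[of 1]
    proof eventually_elim
      case (elim r)
      have "Sup (S r) \<le> C * r powr (\<alpha> + 1) * majorant_integral \<alpha> f r"
        using ne[OF elim] le[OF elim] by (intro cSup_least) auto
      then show ?case using elim by (simp add: divide_le_eq mult_ac)
    qed
    show "((\<lambda>r. C * majorant_integral \<alpha> f r) \<longlongrightarrow> 0) at_top"
      using tendsto_mult_right_zero[OF majorant_integral_tendsto_0[OF a f]] .
  qed simp
  moreover have "\<forall>\<^sub>F r in at_top. r powr (\<alpha> + 1) \<noteq> 0"
    using eventually_ge_at_top[of 1] by eventually_elim auto
  ultimately show "(\<lambda>r. Sup (S r)) \<in> o[at_top](\<lambda>r. r powr (\<alpha> + 1))"
    by (intro smalloI_tendsto)
qed

section \<open>Sums of disjoint tents\<close>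

definition tent :: "'a :: real_normed_vector \<Rightarrow> real \<Rightarrow> 'a \<Rightarrow> real" where
  "tent p \<rho> x = max 0 (1 - 1 / \<rho> * norm (x - p))"

lemma tent_nonneg: "tent p \<rho> x \<ge> 0"
  by (simp add: tent_def)

lemma continuous_tent: "continuous_on S (tent p \<rho>)"
  unfolding tent_def by (intro continuous_intros)

lemma tent_inside:
  assumes "x \<in> ball p \<rho>"
  shows "tent p \<rho> x = 1 - 1 / \<rho> * norm (x - p)"
proof -
  have "norm (x - p) < \<rho>" using assms by (simp add: dist_norm norm_minus_commute)
  moreover from this have "\<rho> > 0" using norm_ge_zero[of "x - p"] by linarith
  ultimately show ?thesis by (simp add: tent_def)
qed

lemma tent_outside:
  assumes "x \<notin> ball p \<rho>" "\<rho> > 0"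
  shows "tent p \<rho> x = 0"
  using assms by (simp add: tent_def dist_norm norm_minus_commute)

lemma tent_le_indicator:
  assumes "\<rho> > 0"
  shows "tent p \<rho> x \<le> indicator (ball p \<rho>) x"
  using tent_outside[OF _ assms, of x p] tent_inside[of x p \<rho>] assms by (auto split: split_indicator)

context
  fixes p :: "nat \<Rightarrow> 'a :: real_normed_vector" and \<rho> c :: "nat \<Rightarrow> real"
  assumes rho: "\<And>k. 0 < \<rho> k" "\<And>k. \<rho> k < 1"
    and lim: "filterlim (\<lambda>k. norm (p k)) at_top sequentially"
begin

definition tent_sum :: "'a \<Rightarrow> real" where
  "tent_sum x = (\<Sum>k. c k * tent (p k) (\<rho> k) x)"

text \<open>A bounded set meets only finitely many of the balls, since the centres tend to infinity and
  the radii are bounded. So near each point the sum of the tents is a finite sum.\<close>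

lemma tents_locally_finite:
  obtains m where "\<And>k x. k \<ge> m \<Longrightarrow> norm x < R \<Longrightarrow> tent (p k) (\<rho> k) x = 0"
proof -
  obtain m where m: "\<And>k. k \<ge> m \<Longrightarrow> norm (p k) \<ge> R + 1"
    using lim unfolding filterlim_at_top eventually_sequentially by blast
  show ?thesis
  proof (rule that[of m])
    fix k and x :: 'a
    assume k: "k \<ge> m" and x: "norm x < R"
    have "norm (p k) - norm x \<le> dist (p k) x" by (simp add: dist_norm norm_triangle_ineq2)
    with m[OF k] x rho(2)[of k] have "x \<notin> ball (p k) (\<rho> k)" by auto
    then show "tent (p k) (\<rho> k) x = 0" using rho(1) by (rule tent_outside)
  qed
qed

lemma tents_sums: "(\<lambda>k. c k * tent (p k) (\<rho> k) x) sums tent_sum x"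
proof -
  obtain m where "\<And>k. k \<ge> m \<Longrightarrow> tent (p k) (\<rho> k) x = 0"
    using tents_locally_finite[of "norm x + 1"] by (metis less_add_one)
  then have "summable (\<lambda>k. c k * tent (p k) (\<rho> k) x)"
    by (intro summable_finite[of "{..<m}"]) (auto simp: not_less)
  then show ?thesis unfolding tent_sum_def by (rule summable_sums)
qed

lemma continuous_tent_sum: "continuous_on UNIV tent_sum"
proof (rule continuous_at_imp_continuous_on, rule ballI)
  fix x0 :: 'a
  obtain m where m: "\<And>k x. k \<ge> m \<Longrightarrow> norm x < norm x0 + 1 \<Longrightarrow> tent (p k) (\<rho> k) x = 0"
    using tents_locally_finite by blast
  have "tent_sum x = (\<Sum>k<m. c k * tent (p k) (\<rho> k) x)" if "x \<in> ball 0 (norm x0 + 1)" for x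
    unfolding tent_sum_def using m that by (intro suminf_finite) auto
  moreover have "continuous_on (ball 0 (norm x0 + 1)) (\<lambda>x. \<Sum>k<m. c k * tent (p k) (\<rho> k) x)"
    by (intro continuous_intros continuous_tent)
  ultimately have "continuous_on (ball 0 (norm x0 + 1)) tent_sum"
    using continuous_on_cong[OF refl] by (metis (no_types, lifting))
  then show "isCont tent_sum x0"
    by (rule continuous_on_interior) simp
qed

lemma tent_sum_inside:
  assumes disj: "disjoint_family (\<lambda>k. ball (p k) (\<rho> k))" and x: "x \<in> ball (p k) (\<rho> k)"
  shows "tent_sum x = c k * (1 - 1 / \<rho> k * norm (x - p k))"
proof -
  have "c j * tent (p j) (\<rho> j) x = 0" if "j \<notin> {k}" for j
  proof -
    have "ball (p j) (\<rho> j) \<inter> ball (p k) (\<rho> k) = {}"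
      using disjoint_family_onD[OF disj] that by simp
    then have "x \<notin> ball (p j) (\<rho> j)" using x by blast
    then show ?thesis using tent_outside rho(1) by auto
  qed
  then have "tent_sum x = (\<Sum>j\<in>{k}. c j * tent (p j) (\<rho> j) x)"
    unfolding tent_sum_def by (intro suminf_finite) auto
  then show ?thesis by (simp add: tent_inside[OF x])
qed

lemma tent_sum_outside:
  assumes "x \<notin> (\<Union>k. ball (p k) (\<rho> k))"
  shows "tent_sum x = 0"
proof -
  have "tent (p k) (\<rho> k) x = 0" for k
    using assms by (intro tent_outside rho(1)) blast
  then show ?thesis by (simp add: tent_sum_def)
qed

lemma tent_sum_nonneg:
  assumes "\<And>k. c k \<ge> 0"
  shows "tent_sum x \<ge> 0"
  by (rule sums_le[OF _ sums_zero tents_sums]) (simp add: assms tent_nonneg)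

end

text \<open>On a ball of radius less than \<open>1\<close> whose centre has norm at least \<open>2\<close>,
  \<open>\<bar>x\<bar> \<ge> \<bar>p\<bar> / 2\<close>, whereas \<open>radius p \<rho> \<le> 2 \<bar>p\<bar>\<close>; hence the factor \<open>4\<close>. Comparing with \<open>radius p \<rho>\<close>
  instead of \<open>\<bar>p\<bar>\<close> makes the powers of the radius cancel when the bump heights are powers of
  it.\<close>

lemma weight_ball_ge:
  fixes x p :: "real ^ 'n"
  assumes a: "\<alpha> > -1" and p: "norm p \<ge> 2" and rho: "0 < \<rho>" "\<rho> < 1" and x: "x \<in> ball p \<rho>"
  shows "(radius p \<rho> / 4) powr (\<alpha> + real CARD('n) + 1) \<le> weight \<alpha> x"
proof -
  define q where "q = (\<alpha> + real CARD('n) + 1) / 2"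
  have q: "q \<ge> 0" using a by (simp add: q_def)
  have r: "radius p \<rho> > 0" by (rule radius_pos[OF rho(1)])
  have "radius p \<rho> \<le> norm p + \<rho>"
    using sqrt_sum_squares_le_sum[of "norm p" \<rho>] rho by (simp add: radius_def)
  moreover have "norm p - norm x \<le> dist p x" by (simp add: dist_norm norm_triangle_ineq2)
  ultimately have "radius p \<rho> / 4 \<le> norm x" using x p rho by auto
  then have "(radius p \<rho> / 4)\<^sup>2 \<le> (norm x)\<^sup>2" using r by (intro power_mono) auto
  then have "((radius p \<rho> / 4)\<^sup>2) powr q \<le> (1 + (norm x)\<^sup>2) powr q"
    using q by (intro powr_mono2) auto
  moreover have "((radius p \<rho> / 4)\<^sup>2) powr q = (radius p \<rho> / 4) powr (2 * q)"
    using r by (simp add: powr_powr flip: powr_numeral)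
  moreover have "2 * q = \<alpha> + real CARD('n) + 1" by (simp add: q_def)
  ultimately show ?thesis by (simp only: weight_def q_def[symmetric])
qed

text \<open>Monotone convergence reduces the norm to the norms of the single tents, and each of these
  is estimated by height times volume of the ball times the largest value of \<open>w\<^sup>-\<^sup>1\<close> there.\<close>

lemma tent_sum_L1_weight:
  fixes p :: "nat \<Rightarrow> real ^ 'n"
  assumes a: "\<alpha> > -1" and rho: "\<And>k. 0 < \<rho> k" "\<And>k. \<rho> k < 1"
    and lim: "filterlim (\<lambda>k. norm (p k)) at_top sequentially"
    and p: "\<And>k. norm (p k) \<ge> 2" and c: "\<And>k. c k \<ge> 0"
    and summ: "summable (\<lambda>k. c k * \<rho> k ^ CARD('n) * radius (p k) (\<rho> k) powr - (\<alpha> + real CARD('n) + 1))"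
  shows "tent_sum p \<rho> c \<in> L1_weight \<alpha>"
proof -
  define s where "s = \<alpha> + real CARD('n) + 1"
  define V where "V = unit_ball_vol (real CARD('n))"
  have V: "V \<ge> 0" by (simp add: V_def)
  define t where "t k = c k * (4 powr s * radius (p k) (\<rho> k) powr - s)" for k
  have t: "t k \<ge> 0" for k using c by (simp add: t_def)
  have cont: "continuous_on UNIV (tent_sum p \<rho> c)"
    by (rule continuous_tent_sum[OF rho lim])
  have nonneg: "tent_sum p \<rho> c x \<ge> 0" for x
    by (rule tent_sum_nonneg[OF rho lim c])
  have each: "(\<integral>\<^sup>+ x. ennreal (c k * tent (p k) (\<rho> k) x * inverse (weight \<alpha> x)) \<partial>lborel)
      \<le> ennreal (t k * (V * \<rho> k ^ CARD('n)))" for k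
  proof -
    have "c k * tent (p k) (\<rho> k) x * inverse (weight \<alpha> x) \<le> t k * indicator (ball (p k) (\<rho> k)) x" for x
    proof (cases "x \<in> ball (p k) (\<rho> k)")
      case True
      have r: "radius (p k) (\<rho> k) > 0" by (rule radius_pos[OF rho(1)])
      have "inverse (weight \<alpha> x) \<le> inverse ((radius (p k) (\<rho> k) / 4) powr s)"
        unfolding s_def using r by (intro le_imp_inverse_le weight_ball_ge a p rho True) auto
      also have "\<dots> = 4 powr s * radius (p k) (\<rho> k) powr - s"
        using r by (simp add: powr_divide powr_minus field_simps)
      finally have "tent (p k) (\<rho> k) x * inverse (weight \<alpha> x) \<le>
          1 * (4 powr s * radius (p k) (\<rho> k) powr - s)"
        using tent_le_indicator[OF rho(1)[of k], of "p k" x] True tent_nonneg[of "p k" "\<rho> k" x] weight_pos[of \<alpha> x]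
        by (intro mult_mono) (auto intro: less_imp_le)
      then show ?thesis using True c[of k] by (simp add: t_def mult_left_mono mult.assoc)
    next
      case False
      then show ?thesis using tent_outside[OF False rho(1)] by simp
    qed
    then have "ennreal (c k * tent (p k) (\<rho> k) x * inverse (weight \<alpha> x)) \<le>
        ennreal (t k) * indicator (ball (p k) (\<rho> k)) x" for x
      using ennreal_leI[of _ "t k * indicator (ball (p k) (\<rho> k)) x"] t[of k]
      by (simp add: ennreal_mult ennreal_indicator)
    then have "(\<integral>\<^sup>+ x. ennreal (c k * tent (p k) (\<rho> k) x * inverse (weight \<alpha> x)) \<partial>lborel)
        \<le> (\<integral>\<^sup>+ x. ennreal (t k) * indicator (ball (p k) (\<rho> k)) x \<partial>lborel)"
      by (rule nn_integral_mono)
    also have "\<dots> = ennreal (t k) * ennreal (V * \<rho> k ^ CARD('n))"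
      using emeasure_ball[of "\<rho> k" "p k"] rho(1)[of k] by (simp add: nn_integral_cmult_indicator V_def)
    also have "\<dots> = ennreal (t k * (V * \<rho> k ^ CARD('n)))"
      using t V rho(1)[of k] by (simp add: ennreal_mult)
    finally show ?thesis .
  qed
  have "summable (\<lambda>k. (4 powr s * V) * (c k * \<rho> k ^ CARD('n) * radius (p k) (\<rho> k) powr - s))"
    using summ by (intro summable_mult) (simp add: s_def)
  then have summ': "summable (\<lambda>k. t k * (V * \<rho> k ^ CARD('n)))" by (simp add: t_def mult_ac)
  have m: "(\<lambda>x. ennreal (c k * tent (p k) (\<rho> k) x * inverse (weight \<alpha> x))) \<in> borel_measurable lborel" for k
  proof -
    have [measurable]: "tent (p k) (\<rho> k) \<in> borel_measurable borel"
      by (rule borel_measurable_continuous_onI[OF continuous_tent])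
    show ?thesis by measurable
  qed
  have "ennreal (\<bar>tent_sum p \<rho> c x\<bar> * inverse (weight \<alpha> x)) =
      (\<Sum>k. ennreal (c k * tent (p k) (\<rho> k) x * inverse (weight \<alpha> x)))" for x
  proof -
    have "(\<lambda>k. c k * tent (p k) (\<rho> k) x * inverse (weight \<alpha> x)) sums
        (tent_sum p \<rho> c x * inverse (weight \<alpha> x))"
      by (rule sums_mult2[OF tents_sums[OF rho lim]])
    then have "(\<lambda>k. ennreal (c k * tent (p k) (\<rho> k) x * inverse (weight \<alpha> x))) sums
        ennreal (tent_sum p \<rho> c x * inverse (weight \<alpha> x))"
      using c tent_nonneg[of _ _ x] weight_pos[of \<alpha> x] nonneg[of x]
      by (subst sums_ennreal) (auto intro!: mult_nonneg_nonneg simp: less_imp_le)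
    then show ?thesis using nonneg[of x] by (simp add: sums_iff)
  qed
  then have "(\<integral>\<^sup>+ x. ennreal (\<bar>tent_sum p \<rho> c x\<bar> * inverse (weight \<alpha> x)) \<partial>lborel) =
      (\<Sum>k. \<integral>\<^sup>+ x. ennreal (c k * tent (p k) (\<rho> k) x * inverse (weight \<alpha> x)) \<partial>lborel)"
    by (simp add: nn_integral_suminf[OF m])
  also have "\<dots> \<le> (\<Sum>k. ennreal (t k * (V * \<rho> k ^ CARD('n))))"
    by (intro suminf_le each) auto
  also have "\<dots> < \<infinity>"
    using summ' t V rho(1) by (subst suminf_ennreal2) (auto intro!: mult_nonneg_nonneg simp: less_imp_le)
  finally have "(\<integral>\<^sup>+ x. ennreal (\<bar>tent_sum p \<rho> c x\<bar> * inverse (weight \<alpha> x)) \<partial>lborel) < \<infinity>" .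
  moreover have "tent_sum p \<rho> c \<in> borel_measurable lebesgue"
    using borel_measurable_continuous_onI[OF cont] by (intro measurable_completion) simp
  ultimately show ?thesis
    unfolding L1_weight_def by (simp add: nn_integral_completion)
qed

section \<open>Sharpness\<close>

text \<open>On \<open>ball p (\<rho> / 2)\<close> the kernel at height \<open>\<rho>\<close> is at least a multiple of \<open>\<rho>\<^sup>-\<^sup>n\<close>, and the volume
  of the ball is a multiple of \<open>\<rho>\<^sup>n\<close>; so the constant \<open>C\<close> is independent of \<open>\<rho>\<close>, \<open>p\<close> and \<open>f\<close>.\<close>

lemma K_transform_lower_bound:
  assumes a: "\<alpha> > -1"
  obtains C where "C > 0" "\<And>(f :: real ^ 'n \<Rightarrow> real) p \<rho> c.
    f \<in> L1_weight \<alpha> \<Longrightarrow> (\<And>x. f x \<ge> 0) \<Longrightarrow> \<rho> > 0 \<Longrightarrow> radius p \<rho> \<ge> 1 \<Longrightarrow> c \<ge> 0 \<Longrightarrow>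
    (\<And>x. x \<in> ball p (\<rho> / 2) \<Longrightarrow> f x \<ge> c) \<Longrightarrow> C * c \<le> K_transform \<alpha> f p \<rho>"
proof -
  define q where "q = (\<alpha> + real CARD('n) + 1) / 2"
  have q: "q \<ge> 0" using a by (simp add: q_def)
  define D where "D = kernel_const \<alpha> (real CARD('n)) / 2 powr q"
  have D: "D > 0" using kernel_const_pos[OF a, of "real CARD('n)"] by (simp add: D_def)
  define C where "C = D * (unit_ball_vol (real CARD('n)) / 2 ^ CARD('n))"
  show ?thesis
  proof (rule that[of C])
    show "C > 0" using D by (simp add: C_def)
    fix f :: "real ^ 'n \<Rightarrow> real" and p \<rho> c
    assume f: "f \<in> L1_weight \<alpha>" "\<And>x. f x \<ge> 0" and rho: "\<rho> > 0" "radius p \<rho> \<ge> 1" and c: "c \<ge> 0"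
      and fc: "\<And>x. x \<in> ball p (\<rho> / 2) \<Longrightarrow> f x \<ge> c"
    have ker: "D / \<rho> ^ CARD('n) \<le> K_kernel \<alpha> (p - x) \<rho>" if "x \<in> ball p (\<rho> / 2)" for x
    proof -
      have "norm (p - x) \<le> \<rho>" using that rho(1) by (simp add: dist_norm)
      then have "(norm (p - x))\<^sup>2 \<le> \<rho>\<^sup>2" by (intro power_mono) auto
      then have "((norm (p - x))\<^sup>2 + \<rho>\<^sup>2) powr q \<le> (2 * \<rho>\<^sup>2) powr q"
        using q by (intro powr_mono2) auto
      also have "\<dots> = 2 powr q * (\<rho> powr (\<alpha> + 1) * \<rho> ^ CARD('n))"
      proof -
        have "(\<rho>\<^sup>2) powr q = \<rho> powr (2 * q)" using rho(1) by (simp add: powr_powr flip: powr_numeral)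
        also have "2 * q = (\<alpha> + 1) + real CARD('n)" by (simp add: q_def)
        finally show ?thesis using rho(1) by (simp add: powr_mult powr_add powr_realpow)
      qed
      finally have le: "((norm (p - x))\<^sup>2 + \<rho>\<^sup>2) powr q \<le> \<dots>" .
      have pos: "((norm (p - x))\<^sup>2 + \<rho>\<^sup>2) powr q > 0"
        using add_nonneg_pos[of "(norm (p - x))\<^sup>2" "\<rho>\<^sup>2"] rho(1) by simp
      have pos': "2 powr q * (\<rho> powr (\<alpha> + 1) * \<rho> ^ CARD('n)) *
          ((norm (p - x))\<^sup>2 + \<rho>\<^sup>2) powr q > 0"
        using rho(1) by (intro mult_pos_pos pos) auto
      have "D / \<rho> ^ CARD('n) = kernel_const \<alpha> (real CARD('n)) *
          (\<rho> powr (\<alpha> + 1) / (2 powr q * (\<rho> powr (\<alpha> + 1) * \<rho> ^ CARD('n))))"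
        using rho(1) by (simp add: D_def)
      also have "\<dots> \<le> K_kernel \<alpha> (p - x) \<rho>"
        unfolding K_kernel_eq q_def[symmetric] using kernel_const_pos[OF a, of "real CARD('n)"]
        by (intro mult_left_mono divide_left_mono le pos') auto
      finally show ?thesis .
    qed
    have "C * c = D / \<rho> ^ CARD('n) * c * measure lebesgue (ball p (\<rho> / 2))"
      using content_ball[of "\<rho> / 2" p] rho(1) by (simp add: C_def power_divide)
    also have "\<dots> = (LINT x|lebesgue. D / \<rho> ^ CARD('n) * c * indicator (ball p (\<rho> / 2)) x)"
      by simp
    also have "\<dots> \<le> (LINT x|lebesgue. K_kernel \<alpha> (p - x) \<rho> * f x)"
    proof (rule integral_mono)
      show "integrable lebesgue (\<lambda>x. D / \<rho> ^ CARD('n) * c * indicator (ball p (\<rho> / 2)) x)"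
        using lmeasurable_ball[of p "\<rho> / 2"]
        by (intro integrable_mult_right integrable_real_indicator) (auto simp: fmeasurable_def)
      show "integrable lebesgue (\<lambda>x. K_kernel \<alpha> (p - x) \<rho> * f x)"
        by (rule K_kernel_times_integrable[OF a f(1) rho])
      show "D / \<rho> ^ CARD('n) * c * indicator (ball p (\<rho> / 2)) x \<le> K_kernel \<alpha> (p - x) \<rho> * f x" for x
      proof (cases "x \<in> ball p (\<rho> / 2)")
        case True
        have "D / \<rho> ^ CARD('n) * c \<le> K_kernel \<alpha> (p - x) \<rho> * f x"
          by (rule mult_mono[OF ker[OF True] fc[OF True] K_kernel_nonneg[OF a] c])
        with True show ?thesis by simp
      next
        case False
        then show ?thesis using f(2)[of x] K_kernel_nonneg[OF a, of "p - x" \<rho>] by simp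
      qed
    qed
    finally show "C * c \<le> K_transform \<alpha> f p \<rho>" by (simp add: K_transform_def)
  qed
qed

lemma axis_balls_disjoint:
  assumes rho: "\<And>k. \<rho> k < 1"
  shows "disjoint_family (\<lambda>k. ball (2 ^ (k + 2) *\<^sub>R axis i 1 :: real ^ 'n) (\<rho> k))"
proof -
  let ?p = "\<lambda>k. 2 ^ (k + 2) *\<^sub>R axis i 1 :: real ^ 'n"
  have far: "ball (?p j) (\<rho> j) \<inter> ball (?p k) (\<rho> k) = {}" if "j < k" for j k
  proof -
    have "(2::real) ^ Suc j \<le> 2 ^ k" using that by (intro power_increasing) auto
    moreover have "(1::real) \<le> 2 ^ j" by simp
    ultimately have "2 \<le> \<bar>4 * (2::real) ^ j - 4 * 2 ^ k\<bar>" unfolding power_Suc by linarith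
    also have "\<dots> = \<bar>2 ^ (j + 2) - 2 ^ (k + 2)\<bar>" by (simp add: power_add)
    also have "\<dots> = dist (?p j) (?p k)"
      by (simp add: dist_norm norm_axis_1 flip: scaleR_left_diff_distrib)
    finally have "\<rho> j + \<rho> k \<le> dist (?p j) (?p k)" using rho[of j] rho[of k] by linarith
    then show ?thesis by (rule disjoint_ballI)
  qed
  show ?thesis
    unfolding disjoint_family_on_def using far by (metis Int_commute linorder_neqE_nat)
qed

text \<open>If \<open>\<beta> + \<gamma> < s\<close>, the growth of \<open>R\<close> gives a geometric majorant, and \<open>\<rho>\<close> is kept constant
  since the sign of \<open>n - \<gamma>\<close> is arbitrary. If \<open>\<beta> + \<gamma> = s\<close>, the powers of \<open>R\<close> disappear, and it is
  the decay of \<open>\<rho>\<close> that forces convergence.\<close>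

lemma summable_bump_norms:
  fixes \<beta> \<gamma> s n :: real and R :: "nat \<Rightarrow> real"
  assumes "\<beta> + \<gamma> < s \<or> \<beta> + \<gamma> = s \<and> \<gamma> < n"
    and R: "\<And>k. R k \<ge> 2 ^ (k + 2)"
  defines "\<rho> \<equiv> \<lambda>k::nat. if \<beta> + \<gamma> < s then 1 / 2 else (1 / 2 :: real) ^ (k + 1)"
  shows "summable (\<lambda>k. R k powr (\<beta> + \<gamma> - s) * \<rho> k powr (n - \<gamma>))"
proof (cases "\<beta> + \<gamma> < s")
  case True
  define \<delta> where "\<delta> = \<beta> + \<gamma> - s"
  have d: "\<delta> < 0" using True by (simp add: \<delta>_def)
  have "2 powr \<delta> < 2 powr (0::real)" using d by (intro powr_less_mono) auto
  then have "summable (\<lambda>k. (1 / 2) powr (n - \<gamma>) * 4 powr \<delta> * (2 powr \<delta>) ^ k)"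
    by (intro summable_mult summable_geometric) simp
  moreover have "R k powr \<delta> * \<rho> k powr (n - \<gamma>) \<le> (1 / 2) powr (n - \<gamma>) * 4 powr \<delta> * (2 powr \<delta>) ^ k" for k
  proof -
    have "R k powr \<delta> \<le> (2 ^ (k + 2)) powr \<delta>"
      using R d by (intro powr_mono2') auto
    also have "\<dots> = 4 powr \<delta> * (2 ^ k) powr \<delta>" by (simp add: power_add powr_mult)
    also have "(2 ^ k) powr \<delta> = (2 powr real k) powr \<delta>" by (simp add: powr_realpow)
    also have "\<dots> = (2 powr \<delta>) powr real k" by (simp only: powr_powr mult.commute)
    also have "\<dots> = (2 powr \<delta>) ^ k" by (simp add: powr_realpow)
    finally show ?thesis using True by (simp add: \<rho>_def mult_ac)
  qed
  ultimately show ?thesis unfolding \<delta>_def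
    by (elim summable_comparison_test'[where N = 0]) simp
next
  case False
  then have g: "\<beta> + \<gamma> = s" "\<gamma> < n" using assms(1) by auto
  have "(1 / 2) powr (n - \<gamma>) < (1 / 2) powr (0::real)" using g by (intro powr_less_mono') auto
  then have "summable (\<lambda>k. (1 / 2) powr (n - \<gamma>) * ((1 / 2) powr (n - \<gamma>)) ^ k)"
    by (intro summable_mult summable_geometric) simp
  moreover have "R k powr (\<beta> + \<gamma> - s) * \<rho> k powr (n - \<gamma>) =
      (1 / 2) powr (n - \<gamma>) * ((1 / 2) powr (n - \<gamma>)) ^ k" for k
  proof -
    have "R k > 0" using R[of k] by (smt (verit) zero_less_power)
    moreover have "\<rho> k powr (n - \<gamma>) = ((1 / 2) powr (n - \<gamma>)) ^ (k + 1)"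
    proof -
      have "\<rho> k = (1 / 2) powr real (k + 1)" using g unfolding \<rho>_def by (subst powr_realpow) auto
      then have "\<rho> k powr (n - \<gamma>) = ((1 / 2) powr (n - \<gamma>)) powr real (k + 1)"
        by (simp only: powr_powr mult.commute)
      then show ?thesis by (simp only: powr_realpow powr_gt_zero)
    qed
    ultimately show ?thesis using g by simp
  qed
  ultimately show ?thesis by simp
qed

lemma sharpness_example:
  fixes i :: "'n :: finite" and \<alpha> \<beta> \<gamma> :: real
  assumes a: "\<alpha> > -1" and bg: "\<beta> + \<gamma> < \<alpha> + real CARD('n) + 1 \<or>
        \<beta> + \<gamma> = \<alpha> + real CARD('n) + 1 \<and> \<gamma> < real CARD('n)"
  obtains c a \<rho> :: "nat \<Rightarrow> real" and f :: "real ^ 'n \<Rightarrow> real" where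
    "\<And>k. 0 < c k \<and> 0 < a k \<and> 0 < \<rho> k \<and> \<rho> k < 1" "filterlim a at_top sequentially"
    "disjoint_family (\<lambda>k. ball (a k *\<^sub>R axis i 1 :: real ^ 'n) (\<rho> k))"
    "\<And>k x. x \<in> ball (a k *\<^sub>R axis i 1) (\<rho> k) \<Longrightarrow>
       f x = c k * (1 - 1 / \<rho> k * norm (x - a k *\<^sub>R axis i 1))"
    "\<And>x. x \<notin> (\<Union>k. ball (a k *\<^sub>R axis i 1) (\<rho> k)) \<Longrightarrow> f x = 0"
    "continuous_on UNIV f" "f \<in> L1_weight \<alpha>"
    "\<not> (\<lambda>k. radius (a k *\<^sub>R axis i 1 :: real ^ 'n) (\<rho> k) powr (- \<beta>) *
                  K_transform \<alpha> f (a k *\<^sub>R axis i 1) (\<rho> k) *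
                  cos (angle (a k *\<^sub>R axis i 1 :: real ^ 'n) (\<rho> k)) powr \<gamma>) \<longlonglongrightarrow> 0"
proof -
  define s where "s = \<alpha> + real CARD('n) + 1"
  define b :: "nat \<Rightarrow> real" where "b k = 2 ^ (k + 2)" for k
  define \<rho> where "\<rho> k = (if \<beta> + \<gamma> < s then 1 / 2 else (1 / 2 :: real) ^ (k + 1))" for k :: nat
  define p :: "nat \<Rightarrow> real ^ 'n" where "p k = b k *\<^sub>R axis i 1" for k
  define R where "R k = radius (p k) (\<rho> k)" for k
  \<comment> \<open>The height for which \<open>R k powr (- \<beta>) * c k * (\<rho> k / R k) powr \<gamma> = 1\<close>.\<close>
  define c where "c k = R k powr (\<beta> + \<gamma>) * \<rho> k powr - \<gamma>" for k
  define f where "f = tent_sum p \<rho> c"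
  have b4: "b k \<ge> 4" for k by (simp add: b_def)
  have rho: "0 < \<rho> k" "\<rho> k < 1" for k
    using power_Suc_less_one[of "1 / 2 :: real" k] by (auto simp: \<rho>_def)
  have np: "norm (p k) = b k" for k using b4[of k] by (simp add: p_def norm_axis_1)
  have R: "R k \<ge> b k" for k
    using real_sqrt_sum_squares_ge1[of "norm (p k)" "\<rho> k"] by (simp add: R_def radius_def np)
  have R0: "R k > 0" for k using R[of k] b4[of k] by linarith
  have c: "c k > 0" for k using R0[of k] rho[of k] by (simp add: c_def)
  have limb: "filterlim b at_top sequentially"
  proof -
    have "real k \<le> b k" for k
    proof -
      have "real k \<le> 2 ^ k" using of_nat_less_two_power[of k, where 'a = real] by simp
      also have "\<dots> \<le> b k" by (simp add: b_def)
      finally show ?thesis .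
    qed
    then show ?thesis
      by (intro filterlim_at_top_mono[OF filterlim_real_sequentially] always_eventually) auto
  qed
  then have lim: "filterlim (\<lambda>k. norm (p k)) at_top sequentially" by (simp add: np)
  have disj: "disjoint_family (\<lambda>k. ball (p k) (\<rho> k))"
    unfolding p_def b_def using rho(2) by (rule axis_balls_disjoint)
  have f0: "f x \<ge> 0" for x
    unfolding f_def using c by (intro tent_sum_nonneg[OF rho lim]) (simp add: less_imp_le)
  have fin: "f x = c k * (1 - 1 / \<rho> k * norm (x - p k))" if "x \<in> ball (p k) (\<rho> k)" for k x
    unfolding f_def by (rule tent_sum_inside[OF rho lim disj that])
  have L1: "f \<in> L1_weight \<alpha>"
    unfolding f_def
  proof (rule tent_sum_L1_weight[OF a rho lim])
    show "norm (p k) \<ge> 2" for k using b4[of k] by (simp add: np)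
    show "c k \<ge> 0" for k using c[of k] by simp
    have "summable (\<lambda>k. R k powr (\<beta> + \<gamma> - s) * \<rho> k powr (real CARD('n) - \<gamma>))"
      unfolding \<rho>_def using bg R by (intro summable_bump_norms) (simp_all add: s_def b_def)
    moreover have "R k powr (\<beta> + \<gamma> - s) * \<rho> k powr (real CARD('n) - \<gamma>) =
        c k * \<rho> k ^ CARD('n) * radius (p k) (\<rho> k) powr - s" for k
      using R0[of k] rho(1)[of k]
      by (simp add: c_def R_def[symmetric] powr_diff powr_minus powr_realpow field_simps)
    ultimately show "summable (\<lambda>k. c k * \<rho> k ^ CARD('n) *
        radius (p k) (\<rho> k) powr - (\<alpha> + real CARD('n) + 1))"
      by (simp add: s_def)
  qed
  obtain C where C: "C > 0" and lower: "\<And>(f :: real ^ 'n \<Rightarrow> real) p \<rho> c.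
    f \<in> L1_weight \<alpha> \<Longrightarrow> (\<And>x. f x \<ge> 0) \<Longrightarrow> \<rho> > 0 \<Longrightarrow> radius p \<rho> \<ge> 1 \<Longrightarrow> c \<ge> 0 \<Longrightarrow>
    (\<And>x. x \<in> ball p (\<rho> / 2) \<Longrightarrow> f x \<ge> c) \<Longrightarrow> C * c \<le> K_transform \<alpha> f p \<rho>"
    using K_transform_lower_bound[OF a, where 'n = 'n] by blast
  have ge: "C / 2 \<le> R k powr (- \<beta>) * K_transform \<alpha> f (p k) (\<rho> k) * cos (angle (p k) (\<rho> k)) powr \<gamma>" for k
  proof -
    have "C * (c k / 2) \<le> K_transform \<alpha> f (p k) (\<rho> k)"
    proof (rule lower[OF L1 f0 rho(1)])
      show "radius (p k) (\<rho> k) \<ge> 1" using R[of k] b4[of k] by (simp add: R_def)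
      show "c k / 2 \<ge> 0" using c[of k] by simp
      fix x assume x: "x \<in> ball (p k) (\<rho> k / 2)"
      then have "x \<in> ball (p k) (\<rho> k)" using rho(1)[of k] by auto
      moreover have "1 / \<rho> k * norm (x - p k) \<le> 1 / 2"
        using x rho(1)[of k] by (simp add: dist_norm norm_minus_commute field_simps)
      ultimately show "c k / 2 \<le> f x" using c[of k] mult_left_mono[of "1/2" _ "c k"] by (simp add: fin)
    qed
    then have "R k powr (- \<beta>) * (C * (c k / 2)) * (\<rho> k / R k) powr \<gamma> \<le>
        R k powr (- \<beta>) * K_transform \<alpha> f (p k) (\<rho> k) * (\<rho> k / R k) powr \<gamma>"
      by (intro mult_right_mono mult_left_mono) auto
    moreover have "R k powr (- \<beta>) * (C * (c k / 2)) * (\<rho> k / R k) powr \<gamma> = C / 2"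
      using R0[of k] rho(1)[of k] by (simp add: c_def powr_divide powr_add powr_minus field_simps)
    ultimately show ?thesis by (simp only: cos_angle[OF rho(1)] flip: R_def)
  qed
  show ?thesis
  proof (rule that[of c b \<rho> f])
    show "\<not> (\<lambda>k. radius (b k *\<^sub>R axis i 1 :: real ^ 'n) (\<rho> k) powr (- \<beta>) *
                  K_transform \<alpha> f (b k *\<^sub>R axis i 1) (\<rho> k) *
                  cos (angle (b k *\<^sub>R axis i 1 :: real ^ 'n) (\<rho> k)) powr \<gamma>) \<longlonglongrightarrow> 0"
    proof
      assume "(\<lambda>k. radius (b k *\<^sub>R axis i 1 :: real ^ 'n) (\<rho> k) powr (- \<beta>) *
                  K_transform \<alpha> f (b k *\<^sub>R axis i 1) (\<rho> k) *
                  cos (angle (b k *\<^sub>R axis i 1 :: real ^ 'n) (\<rho> k)) powr \<gamma>) \<longlonglongrightarrow> 0"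
      then have "C / 2 \<le> 0"
        using ge unfolding R_def p_def by (intro LIMSEQ_le_const) auto
      with C show False by simp
    qed
    show "continuous_on UNIV f" unfolding f_def by (rule continuous_tent_sum[OF rho lim])
    show "f x = 0" if "x \<notin> (\<Union>k. ball (b k *\<^sub>R axis i 1) (\<rho> k))" for x
      unfolding f_def using that by (intro tent_sum_outside[OF rho lim]) (simp add: p_def)
    show "0 < c k \<and> 0 < b k \<and> 0 < \<rho> k \<and> \<rho> k < 1" for k
      using c[of k] rho[of k] b4[of k] by linarith
    show "f x = c k * (1 - 1 / \<rho> k * norm (x - b k *\<^sub>R axis i 1))"
      if "x \<in> ball (b k *\<^sub>R axis i 1) (\<rho> k)" for k x
      using fin that unfolding p_def .
  qed (fact limb disj[unfolded p_def] L1)+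
qed

theorem mainTheorem5:
  fixes \<alpha> :: real and i :: "'n::finite"
  assumes "\<alpha> > -1"
  shows
    "(\<forall>f :: real ^ 'n \<Rightarrow> real. f \<in> L1_weight \<alpha> \<longrightarrow>
        (\<forall>\<^sub>F r in at_top. bdd_above
           ((\<lambda>(x, y). \<bar>K_transform \<alpha> f x y * cos (angle x y) ^ CARD('n)\<bar>) ` half_sphere r)) \<and>
        (\<lambda>r. SUP (x, y) \<in> half_sphere r. \<bar>K_transform \<alpha> f x y * cos (angle x y) ^ CARD('n)\<bar>)
          \<in> o[at_top](\<lambda>r. r powr (\<alpha> + 1)))
     \<and>
     (\<forall>\<beta> \<gamma> :: real.
        \<beta> + \<gamma> < \<alpha> + real CARD('n) + 1 \<or>
        \<beta> + \<gamma> = \<alpha> + real CARD('n) + 1 \<and> \<gamma> < real CARD('n) \<longrightarrow>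
        (\<exists>(c :: nat \<Rightarrow> real) (a :: nat \<Rightarrow> real) (\<rho> :: nat \<Rightarrow> real) (f :: real ^ 'n \<Rightarrow> real).
           (\<forall>k. 0 < c k \<and> 0 < a k \<and> 0 < \<rho> k \<and> \<rho> k < 1) \<and>
           filterlim a at_top sequentially \<and>
           disjoint_family (\<lambda>k. ball (a k *\<^sub>R axis i 1 :: real ^ 'n) (\<rho> k)) \<and>
           (\<forall>k. \<forall>x \<in> ball (a k *\<^sub>R axis i 1) (\<rho> k).
              f x = c k * (1 - 1 / \<rho> k * norm (x - a k *\<^sub>R axis i 1))) \<and>
           (\<forall>x. x \<notin> (\<Union>k. ball (a k *\<^sub>R axis i 1) (\<rho> k)) \<longrightarrow> f x = 0) \<and>
           continuous_on UNIV f \<and>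
           f \<in> L1_weight \<alpha> \<and>
           \<not> (\<lambda>k. radius (a k *\<^sub>R axis i 1 :: real ^ 'n) (\<rho> k) powr (- \<beta>) *
                  K_transform \<alpha> f (a k *\<^sub>R axis i 1) (\<rho> k) *
                  cos (angle (a k *\<^sub>R axis i 1 :: real ^ 'n) (\<rho> k)) powr \<gamma>) \<longlonglongrightarrow> 0))"
proof (intro conjI allI impI)
  fix f :: "real ^ 'n \<Rightarrow> real" assume f: "f \<in> L1_weight \<alpha>"
  show "\<forall>\<^sub>F r in at_top. bdd_above
      ((\<lambda>(x, y). \<bar>K_transform \<alpha> f x y * cos (angle x y) ^ CARD('n)\<bar>) ` half_sphere r)"
    by (rule K_transform_smallo(1)[OF assms f])
  show "(\<lambda>r. SUP (x, y) \<in> half_sphere r. \<bar>K_transform \<alpha> f x y * cos (angle x y) ^ CARD('n)\<bar>)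
      \<in> o[at_top](\<lambda>r. r powr (\<alpha> + 1))"
    by (rule K_transform_smallo(2)[OF assms f])
next
  fix \<beta> \<gamma> :: real
  assume bg: "\<beta> + \<gamma> < \<alpha> + real CARD('n) + 1 \<or>
        \<beta> + \<gamma> = \<alpha> + real CARD('n) + 1 \<and> \<gamma> < real CARD('n)"
  show "\<exists>(c :: nat \<Rightarrow> real) (a :: nat \<Rightarrow> real) (\<rho> :: nat \<Rightarrow> real) (f :: real ^ 'n \<Rightarrow> real).
           (\<forall>k. 0 < c k \<and> 0 < a k \<and> 0 < \<rho> k \<and> \<rho> k < 1) \<and>
           filterlim a at_top sequentially \<and>
           disjoint_family (\<lambda>k. ball (a k *\<^sub>R axis i 1 :: real ^ 'n) (\<rho> k)) \<and>
           (\<forall>k. \<forall>x \<in> ball (a k *\<^sub>R axis i 1) (\<rho> k).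
              f x = c k * (1 - 1 / \<rho> k * norm (x - a k *\<^sub>R axis i 1))) \<and>
           (\<forall>x. x \<notin> (\<Union>k. ball (a k *\<^sub>R axis i 1) (\<rho> k)) \<longrightarrow> f x = 0) \<and>
           continuous_on UNIV f \<and>
           f \<in> L1_weight \<alpha> \<and>
           \<not> (\<lambda>k. radius (a k *\<^sub>R axis i 1 :: real ^ 'n) (\<rho> k) powr (- \<beta>) *
                  K_transform \<alpha> f (a k *\<^sub>R axis i 1) (\<rho> k) *
                  cos (angle (a k *\<^sub>R axis i 1 :: real ^ 'n) (\<rho> k)) powr \<gamma>) \<longlonglongrightarrow> 0"
    by (rule sharpness_example[OF assms bg, of i]) blast
qed

end
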